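(* Consider the problem $\min_{x\in\mathbb{R}^n}F(x)$ with $F=(F_1,\dots,F_m)$, $F_i=f_i+g_i$, where each $f_i$ is continuously differentiable and each $g_i$ is proper, convex and lower semicontinuous. Assume that $f_i$ is $L_i$-smooth and strongly convex with modulus $\mu_i>0$, for every $i\in[m]$. Let $\{x^k\}$ be the (infinite) sequence generated by the Barzilai-Borwein proximal gradient method with line search (BBPGMO, described in the context), where $\alpha_{\min}$ is small enough and $\alpha_{\max}$ large enough that $\alpha_{\min}\le\min_{i\in[m]}\mu_i$ and $\alpha_{\max}\ge\max_{i\in[m]}L_i$. Then: (i) $\{x^k\}$ converges to some Pareto solution $x^*$. (ii) For all $k\ge 0$, $$u_0^{\mu}(x^{k+1})\le\left(1-2\gamma\sigma(1-\sigma)\left(\min_{i\in[m]}\left\{\frac{\mu_i}{L_i}\right\}\right)^3\right)u_0^{\mu}(x^k),$$ where $u_0^\mu(x)=\sup_{y\in\mathbb{R}^n}\min_{i\in[m]}\left\{\frac{F_i(x)-F_i(y)}{\mu_i}\right\}$.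
   Context: Notation: $[m]=\{1,\dots,m\}$; for $u,v\in\mathbb{R}^m$, $u\preceq v$ means $u_i\le v_i$ for all $i$. $F:\mathbb{R}^n\to\mathbb{R}^m$. A point $x^*$ is a Pareto solution if there is no $x$ with $F(x)\preceq F(x^* )$ and $F(x)\ne F(x^* )$. It is Pareto critical if $\max_{i\in[m]}F_i'(x^*;d)\ge0$ for all $d\in\mathbb{R}^n$, where $F_i'(x;d)$ is the directional derivative. A differentiable $h$ is $L$-smooth if $\|\nabla h(y)-\nabla h(x)\|\le L\|y-x\|$ for all $x,y$, and $\mu$-strongly convex if $\langle\nabla h(y)-\nabla h(x),y-x\rangle\ge\mu\|y-x\|^2$ for all $x,y$. BBPGMO with line search. Fix $\sigma,\gamma\in(0,1)$ and constants $0<\alpha_{\min}<\alpha_{\max}$. Given $x^0$, choose $x^{-1}\ne x^0$ in a small neighborhood of $x^0$. For $k=0,1,2,\dots$: 1. With $s^{k-1}=x^k-x^{k-1}$ and $y_i^{k-1}=\nabla f_i(x^k)-\nabla f_i(x^{k-1})$, set for each $i\in[m]$: $\alpha_i^k=\max\{\alpha_{\min},\min\{\langle s^{k-1},y_i^{k-1}\rangle/\langle s^{k-1},s^{k-1}\rangle,\alpha_{\max}\}\}$ if $\langle s^{k-1},y_i^{k-1}\rangle>0$; $\alpha_i^k=\max\{\alpha_{\min},\min\{\|y_i^{k-1}\|/\|s^{k-1}\|,\alpha_{\max}\}\}$ if $\langle s^{k-1},y_i^{k-1}\rangle<0$; $\alpha_i^k=\alpha_{\min}$ if $\langle s^{k-1},y_i^{k-1}\rangle=0$.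 2. Let $P_{\alpha^k}(x^k)$ be the unique minimizer over $x\in\mathbb{R}^n$ of $\max_{i\in[m]}\left\{\frac{\langle\nabla f_i(x^k),x-x^k\rangle+g_i(x)-g_i(x^k)}{\alpha_i^k}+\frac12\|x-x^k\|^2\right\}$ and set $d^k=P_{\alpha^k}(x^k)-x^k$. Stop if $d^k=0$. 3. Let $t_k$ be the largest element of $\{\gamma^j:j=0,1,2,\dots\}$ such that $F_i(x^k+t_kd^k)-F_i(x^k)\le t_k\sigma\left(\langle\nabla f_i(x^k),d^k\rangle+g_i(x^k+d^k)-g_i(x^k)\right)$ for all $i\in[m]$ (Armijo backtracking starting at $1$), and set $x^{k+1}=x^k+t_kd^k$. Standing assumption: the algorithm does not stop, i.e. it produces an infinite sequence of points that are not Pareto critical. *)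

theory Defs
  imports "HOL-Analysis.Analysis"
begin

text \<open>
  The index set \<open>[m]\<close> is a finite type \<open>'m\<close>. The nonsmooth parts \<open>g i\<close>, and hence the
  objectives \<open>F i = f i + g i\<close>, take values in \<open>ereal\<close>, so that ``proper'' and ``lower
  semicontinuous'' have their usual meaning. Real-valued objectives are the case where every
  \<open>g i\<close> is finite everywhere.
\<close>

definition gradient :: "('a::real_inner \<Rightarrow> real) \<Rightarrow> 'a \<Rightarrow> 'a" where
  "gradient h x = (THE D. GDERIV h x :> D)"

definition continuously_differentiable :: "('a::real_inner \<Rightarrow> real) \<Rightarrow> bool" where
  "continuously_differentiable h \<longleftrightarrow>
     (\<forall>x. h differentiable (at x)) \<and> continuous_on UNIV (gradient h)"

definition smooth_with :: "real \<Rightarrow> ('a::real_inner \<Rightarrow> real) \<Rightarrow> bool" where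
  "smooth_with L h \<longleftrightarrow> (\<forall>x. h differentiable (at x)) \<and>
     (\<forall>x y. norm (gradient h y - gradient h x) \<le> L * norm (y - x))"

definition strongly_convex_with :: "real \<Rightarrow> ('a::real_inner \<Rightarrow> real) \<Rightarrow> bool" where
  "strongly_convex_with \<mu> h \<longleftrightarrow> (\<forall>x. h differentiable (at x)) \<and>
     (\<forall>x y. (gradient h y - gradient h x) \<bullet> (y - x) \<ge> \<mu> * (norm (y - x))\<^sup>2)"

definition proper_fun :: "('a \<Rightarrow> ereal) \<Rightarrow> bool" where
  "proper_fun g \<longleftrightarrow> (\<forall>x. g x \<noteq> -\<infinity>) \<and> (\<exists>x. g x \<noteq> \<infinity>)"

text \<open>In \<open>ereal\<close>, \<open>0 * \<infinity> = 0\<close>, so the endpoint cases \<open>u = 0\<close> and \<open>v = 0\<close> below are trivial.\<close>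

definition convex_fun :: "('a::real_vector \<Rightarrow> ereal) \<Rightarrow> bool" where
  "convex_fun g \<longleftrightarrow> (\<forall>x y u v. u \<ge> 0 \<longrightarrow> v \<ge> 0 \<longrightarrow> u + v = 1 \<longrightarrow>
     g (u *\<^sub>R x + v *\<^sub>R y) \<le> ereal u * g x + ereal v * g y)"

definition lsc_fun :: "('a::topological_space \<Rightarrow> ereal) \<Rightarrow> bool" where
  "lsc_fun g \<longleftrightarrow> (\<forall>x. g x \<le> Liminf (at x) g)"

definition objective :: "('m \<Rightarrow> 'a \<Rightarrow> real) \<Rightarrow> ('m \<Rightarrow> 'a \<Rightarrow> ereal) \<Rightarrow> 'm \<Rightarrow> 'a \<Rightarrow> ereal" where
  "objective f g i x = ereal (f i x) + g i x"

definition pareto_solution :: "('m \<Rightarrow> 'a \<Rightarrow> ereal) \<Rightarrow> 'a \<Rightarrow> bool" where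
  "pareto_solution F xs \<longleftrightarrow> (\<forall>i. \<bar>F i xs\<bar> \<noteq> \<infinity>) \<and>
     \<not> (\<exists>x. (\<forall>i. F i x \<le> F i xs) \<and> (\<exists>i. F i x \<noteq> F i xs))"

definition dir_deriv :: "('a::real_vector \<Rightarrow> ereal) \<Rightarrow> 'a \<Rightarrow> 'a \<Rightarrow> ereal" where
  "dir_deriv h x d = Lim (at_right 0) (\<lambda>t::real. (h (x + t *\<^sub>R d) - h x) / ereal t)"

definition pareto_critical :: "('m::finite \<Rightarrow> 'a::real_vector \<Rightarrow> ereal) \<Rightarrow> 'a \<Rightarrow> bool" where
  "pareto_critical F x \<longleftrightarrow> (\<forall>d. (MAX i. dir_deriv (F i) x d) \<ge> 0)"

definition merit ::
  "('m::finite \<Rightarrow> real) \<Rightarrow> ('m \<Rightarrow> 'a \<Rightarrow> ereal) \<Rightarrow> 'a \<Rightarrow> ereal" where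
  "merit \<mu> F x = (SUP y. MIN i. (F i x - F i y) / ereal (\<mu> i))"

definition bb_coeff :: "real \<Rightarrow> real \<Rightarrow> 'a::real_inner \<Rightarrow> 'a \<Rightarrow> real" where
  "bb_coeff \<alpha>min \<alpha>max s y =
     (if s \<bullet> y > 0 then max \<alpha>min (min ((s \<bullet> y) / (s \<bullet> s)) \<alpha>max)
      else if s \<bullet> y < 0 then max \<alpha>min (min (norm y / norm s) \<alpha>max)
      else \<alpha>min)"

text \<open>\<open>lin_decrease f g i x p\<close> is \<open>\<langle>\<nabla>f\<^sub>i(x), p - x\<rangle> + g\<^sub>i(p) - g\<^sub>i(x)\<close>.\<close>

definition lin_decrease ::
  "('m \<Rightarrow> 'a::real_inner \<Rightarrow> real) \<Rightarrow> ('m \<Rightarrow> 'a \<Rightarrow> ereal) \<Rightarrow> 'm \<Rightarrow> 'a \<Rightarrow> 'a \<Rightarrow> ereal" where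
  "lin_decrease f g i x p = ereal (gradient (f i) x \<bullet> (p - x)) + g i p - g i x"

definition subproblem ::
  "('m::finite \<Rightarrow> 'a::real_inner \<Rightarrow> real) \<Rightarrow> ('m \<Rightarrow> 'a \<Rightarrow> ereal) \<Rightarrow> ('m \<Rightarrow> real)
    \<Rightarrow> 'a \<Rightarrow> 'a \<Rightarrow> ereal" where
  "subproblem f g \<alpha> x p =
     (MAX i. lin_decrease f g i x p / ereal (\<alpha> i) + ereal (1 / 2 * (norm (p - x))\<^sup>2))"

definition armijo_steps ::
  "real \<Rightarrow> real \<Rightarrow> ('m \<Rightarrow> 'a::real_inner \<Rightarrow> real) \<Rightarrow> ('m \<Rightarrow> 'a \<Rightarrow> ereal)
    \<Rightarrow> 'a \<Rightarrow> 'a \<Rightarrow> real set" where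
  "armijo_steps \<sigma> \<gamma> f g x d =
     {t. (\<exists>j::nat. t = \<gamma> ^ j) \<and>
         (\<forall>i. objective f g i (x + t *\<^sub>R d) - objective f g i x
                \<le> ereal (t * \<sigma>) * lin_decrease f g i x (x + d))}"

text \<open>
  One iteration that does not stop: from the previous point \<open>xp\<close> and the current point \<open>x\<close>
  to the next point \<open>xn\<close>. The minimizer of the subproblem is unique by strong convexity, so
  it suffices to say that \<open>x + d\<close> is a minimizer.
\<close>

definition bbpgmo_step ::
  "real \<Rightarrow> real \<Rightarrow> real \<Rightarrow> real \<Rightarrow> ('m::finite \<Rightarrow> 'a::real_inner \<Rightarrow> real)
    \<Rightarrow> ('m \<Rightarrow> 'a \<Rightarrow> ereal) \<Rightarrow> 'a \<Rightarrow> 'a \<Rightarrow> 'a \<Rightarrow> bool" where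
  "bbpgmo_step \<sigma> \<gamma> \<alpha>min \<alpha>max f g xp x xn \<longleftrightarrow>
     (\<exists>\<alpha> d t.
        (\<forall>i. \<alpha> i = bb_coeff \<alpha>min \<alpha>max (x - xp) (gradient (f i) x - gradient (f i) xp)) \<and>
        is_arg_min (subproblem f g \<alpha> x) (\<lambda>_. True) (x + d) \<and>
        d \<noteq> 0 \<and>
        t \<in> armijo_steps \<sigma> \<gamma> f g x d \<and>
        (\<forall>s \<in> armijo_steps \<sigma> \<gamma> f g x d. s \<le> t) \<and>
        xn = x + t *\<^sub>R d)"

text \<open>
  \<open>xm\<close> is the auxiliary point \<open>x\<^sup>-\<^sup>1\<close>; it may be any point other than \<open>x 0\<close>, which in
  particular covers every choice near \<open>x 0\<close>.
\<close>

definition bbpgmo_sequence ::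
  "real \<Rightarrow> real \<Rightarrow> real \<Rightarrow> real \<Rightarrow> ('m::finite \<Rightarrow> 'a::real_inner \<Rightarrow> real)
    \<Rightarrow> ('m \<Rightarrow> 'a \<Rightarrow> ereal) \<Rightarrow> 'a \<Rightarrow> (nat \<Rightarrow> 'a) \<Rightarrow> bool" where
  "bbpgmo_sequence \<sigma> \<gamma> \<alpha>min \<alpha>max f g xm x \<longleftrightarrow>
     xm \<noteq> x 0 \<and>
     (\<forall>k. bbpgmo_step \<sigma> \<gamma> \<alpha>min \<alpha>max f g
            (case k of 0 \<Rightarrow> xm | Suc j \<Rightarrow> x j) (x k) (x (Suc k)))"

end

theory Submission
  imports Defs
begin

text \<open>
  By the curvature bounds the Barzilai--Borwein coefficients satisfy
  \<open>\<mu>\<^sub>i \<le> \<alpha>\<^sub>i \<le> L\<^sub>i\<close>. Let \<open>- v\<close> be the optimal value of the subproblem at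
  \<open>x\<close> and \<open>\<kappa> = min \<mu>\<^sub>i / L\<^sub>i\<close>. Testing the subproblem with \<open>x + \<kappa> (y - x)\<close> for
  arbitrary \<open>y\<close> bounds the merit function at \<open>x\<close> by \<open>v / \<kappa>\<^sup>2\<close>; in particular the merit function
  is finite because a minimizer exists. The line search decreases every \<open>F\<^sub>i / \<mu>\<^sub>i\<close> by at least
  \<open>2 \<gamma> \<sigma> (1 - \<sigma>) \<kappa> v\<close>, which gives the linear rate. The decrease also dominates
  \<open>\<sigma> \<parallel>x\<^sup>+ - x\<parallel>\<^sup>2\<close> and is, in some component, at most the merit value; hence the steps are
  summable. At the limit the merit function vanishes, and strong convexity, applied at a midpoint, turns
  this weak Pareto optimality into Pareto optimality.
\<close>

section \<open>Gradients and the quadratic bounds from smoothness and strong convexity\<close>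

text \<open>\<open>gradient\<close> is a definite description, so existence and uniqueness come
  first; the representing vector is assembled from the values of the derivative on
  \<open>Basis\<close>.\<close>

lemma GDERIV_gradient:
  fixes h :: "'a::euclidean_space \<Rightarrow> real"
  assumes "h differentiable (at x)"
  shows "GDERIV h x :> gradient h x"
proof -
  obtain h' where h': "(h has_derivative h') (at x)"
    using assms by (auto simp: differentiable_def)
  interpret h': linear h'
    using h' by (rule has_derivative_linear)
  let ?D = "\<Sum>b\<in>Basis. h' b *\<^sub>R b"
  have "h' v = v \<bullet> ?D" for v
  proof -
    have "h' v = h' (\<Sum>b\<in>Basis. (v \<bullet> b) *\<^sub>R b)"
      by (simp add: euclidean_representation)
    also have "\<dots> = v \<bullet> ?D"
      by (simp add: h'.sum h'.scaleR inner_sum_right mult.commute)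
    finally show ?thesis .
  qed
  then have D: "GDERIV h x :> ?D"
    using h' unfolding gderiv_def by (metis (no_types, lifting) ext)
  have "D' = ?D" if "GDERIV h x :> D'" for D'
  proof -
    have "(\<lambda>v. v \<bullet> D') = (\<lambda>v. v \<bullet> ?D)"
      using has_derivative_unique that D unfolding gderiv_def by blast
    then show ?thesis
      by (simp add: fun_eq_iff vector_eq_ldot)
  qed
  with D have "gradient h x = ?D"
    unfolding gradient_def by (rule the_equality)
  with D show ?thesis
    by simp
qed

lemma has_real_derivative_along_segment:
  fixes h :: "'a::euclidean_space \<Rightarrow> real"
  assumes "\<And>x. h differentiable (at x)"
  shows "((\<lambda>s. h (x + s *\<^sub>R d)) has_real_derivative gradient h (x + s *\<^sub>R d) \<bullet> d) (at s)"
proof -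
  have "(h has_derivative (\<lambda>v. v \<bullet> gradient h (x + s *\<^sub>R d))) (at (x + s *\<^sub>R d))"
    using GDERIV_gradient[OF assms] unfolding gderiv_def by blast
  moreover have "((\<lambda>s. x + s *\<^sub>R d) has_derivative (\<lambda>r. r *\<^sub>R d)) (at s)"
    by (auto intro!: derivative_eq_intros)
  ultimately have "((\<lambda>s. h (x + s *\<^sub>R d)) has_derivative
      (\<lambda>r. (r *\<^sub>R d) \<bullet> gradient h (x + s *\<^sub>R d))) (at s)"
    using diff_chain_at[of "\<lambda>s. x + s *\<^sub>R d"] by (fastforce simp: o_def)
  then show ?thesis
    by (simp add: has_field_derivative_def inner_commute mult.commute[of _ "_ \<bullet> _"])
qed

text \<open>The descent lemma, without integration: \<open>\<phi>\<close> is \<open>h\<close> along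
  the segment minus the linear and quadratic terms, and Cauchy-Schwarz with the Lipschitz gradient
  makes its derivative nonpositive.\<close>

lemma smooth_upper_bound:
  fixes h :: "'a::euclidean_space \<Rightarrow> real"
  assumes "smooth_with L h"
  shows "h y \<le> h x + gradient h x \<bullet> (y - x) + L / 2 * (norm (y - x))\<^sup>2"
proof -
  define d where "d = y - x"
  define \<phi> where "\<phi> s = h (x + s *\<^sub>R d) - s * (gradient h x \<bullet> d) - L / 2 * s\<^sup>2 * (norm d)\<^sup>2" for s
  have "\<phi> 1 \<le> \<phi> 0"
  proof (rule DERIV_nonpos_imp_nonincreasing[where f = \<phi>])
    fix s :: real assume s: "0 \<le> s"
    have "(\<phi> has_real_derivative
        (gradient h (x + s *\<^sub>R d) - gradient h x) \<bullet> d - L * s * (norm d)\<^sup>2) (at s)"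
      unfolding \<phi>_def using assms
      by (auto intro!: derivative_eq_intros has_real_derivative_along_segment
          simp: smooth_with_def inner_diff_left)
    moreover have "(gradient h (x + s *\<^sub>R d) - gradient h x) \<bullet> d \<le> L * s * (norm d)\<^sup>2"
    proof -
      have "norm (gradient h (x + s *\<^sub>R d) - gradient h x) \<le> L * (s * norm d)"
        using assms s unfolding smooth_with_def
        by (metis abs_of_nonneg add_diff_cancel_left' norm_scaleR)
      then have "norm (gradient h (x + s *\<^sub>R d) - gradient h x) * norm d \<le> L * (s * norm d) * norm d"
        by (rule mult_right_mono) simp
      with norm_cauchy_schwarz[of "gradient h (x + s *\<^sub>R d) - gradient h x" d] show ?thesis
        by (simp add: power2_eq_square mult.assoc)
    qed
    ultimately show "\<exists>D. (\<phi> has_real_derivative D) (at s) \<and> D \<le> 0"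
      by (intro exI conjI) (assumption, simp)
  qed simp
  then show ?thesis
    by (simp add: \<phi>_def d_def)
qed

lemma strongly_convex_lower_bound:
  fixes h :: "'a::euclidean_space \<Rightarrow> real"
  assumes "strongly_convex_with \<mu> h"
  shows "h y \<ge> h x + gradient h x \<bullet> (y - x) + \<mu> / 2 * (norm (y - x))\<^sup>2"
proof -
  define d where "d = y - x"
  define \<phi> where "\<phi> s = h (x + s *\<^sub>R d) - s * (gradient h x \<bullet> d) - \<mu> / 2 * s\<^sup>2 * (norm d)\<^sup>2" for s
  have "\<phi> 0 \<le> \<phi> 1"
  proof (rule DERIV_nonneg_imp_nondecreasing[where f = \<phi>])
    fix s :: real assume s: "0 \<le> s"
    have "(\<phi> has_real_derivative
        (gradient h (x + s *\<^sub>R d) - gradient h x) \<bullet> d - \<mu> * s * (norm d)\<^sup>2) (at s)"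
      unfolding \<phi>_def using assms
      by (auto intro!: derivative_eq_intros has_real_derivative_along_segment
          simp: strongly_convex_with_def inner_diff_left)
    moreover have "(gradient h (x + s *\<^sub>R d) - gradient h x) \<bullet> d \<ge> \<mu> * s * (norm d)\<^sup>2"
    \<comment> \<open>Strong convexity is applied to \<open>x + s *\<^sub>R d\<close> and
      \<open>x\<close>, and the result is divided by \<open>s\<close>.\<close>
    proof (cases "s = 0")
      case False
      have "(gradient h (x + s *\<^sub>R d) - gradient h x) \<bullet> (s *\<^sub>R d) \<ge> \<mu> * (norm (s *\<^sub>R d))\<^sup>2"
        using assms unfolding strongly_convex_with_def by (metis add_diff_cancel_left')
      then have "s * ((gradient h (x + s *\<^sub>R d) - gradient h x) \<bullet> d) \<ge> s * (\<mu> * s * (norm d)\<^sup>2)"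
        by (simp add: power2_eq_square mult_ac)
      with False s show ?thesis
        by simp
    qed simp
    ultimately show "\<exists>D. (\<phi> has_real_derivative D) (at s) \<and> 0 \<le> D"
      by (intro exI conjI) (assumption, simp)
  qed simp
  then show ?thesis
    by (simp add: \<phi>_def d_def)
qed

text \<open>Add the quadratic lower bounds based at the midpoint for both endpoints: the linear
  terms cancel, and each endpoint lies at half the distance.\<close>

lemma strongly_convex_midpoint:
  fixes h :: "'a::euclidean_space \<Rightarrow> real"
  assumes "strongly_convex_with \<mu> h"
  shows "h (midpoint x y) \<le> (h x + h y) / 2 - \<mu> / 8 * (norm (y - x))\<^sup>2"
proof -
  let ?z = "midpoint x y" and ?w = "(1 / 2) *\<^sub>R (y - x)"
  have w: "y - ?z = ?w" "x - ?z = - ?w"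
    by (simp_all add: midpoint_def algebra_simps) (simp_all flip: scaleR_add_left)
  have "norm ?w = norm (y - x) / 2"
    by simp
  then have "(norm ?w)\<^sup>2 = (norm (y - x))\<^sup>2 / 4"
    by (simp only: power_divide) simp
  then have "h y \<ge> h ?z + gradient h ?z \<bullet> ?w + \<mu> / 2 * ((norm (y - x))\<^sup>2 / 4)"
    and "h x \<ge> h ?z - gradient h ?z \<bullet> ?w + \<mu> / 2 * ((norm (y - x))\<^sup>2 / 4)"
    using strongly_convex_lower_bound[OF assms, of ?z y] strongly_convex_lower_bound[OF assms, of ?z x]
    unfolding w by (simp_all only: norm_minus_cancel inner_minus_right)
  then show ?thesis
    by (simp add: field_simps)
qed

section \<open>Barzilai-Borwein coefficients and the full-step inequality\<close>

lemma bb_quotient_bounds: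
  fixes h :: "'a::euclidean_space \<Rightarrow> real"
  assumes "smooth_with L h" "strongly_convex_with \<mu> h" "x \<noteq> y"
  defines "r \<equiv> ((x - y) \<bullet> (gradient h x - gradient h y)) / ((x - y) \<bullet> (x - y))"
  shows "\<mu> \<le> r" "r \<le> L"
proof -
  have pos: "(x - y) \<bullet> (x - y) > 0"
    using assms by simp
  have "\<mu> * (norm (x - y))\<^sup>2 \<le> (gradient h x - gradient h y) \<bullet> (x - y)"
    using assms unfolding strongly_convex_with_def by blast
  then show "\<mu> \<le> r"
    unfolding r_def using pos by (simp add: pos_le_divide_eq power2_norm_eq_inner inner_commute)
  have "norm (gradient h x - gradient h y) \<le> L * norm (x - y)"
    using assms unfolding smooth_with_def by blast
  then have "norm (x - y) * norm (gradient h x - gradient h y) \<le> norm (x - y) * (L * norm (x - y))"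
    by (rule mult_left_mono) simp
  then have "(x - y) \<bullet> (gradient h x - gradient h y) \<le> L * (norm (x - y))\<^sup>2"
    using norm_cauchy_schwarz[of "x - y" "gradient h x - gradient h y"]
    by (simp add: power2_eq_square mult_ac)
  then show "r \<le> L"
    unfolding r_def using pos by (simp add: pos_divide_le_eq power2_norm_eq_inner)
qed

text \<open>Strong convexity makes the inner product positive, so only the first branch of
  \<open>bb_coeff\<close> occurs, and the quotient already lies in \<open>[a, b]\<close>, so
  clipping does not change it.\<close>

lemma bb_coeff_bounds:
  fixes h :: "'a::euclidean_space \<Rightarrow> real"
  assumes "smooth_with L h" "strongly_convex_with \<mu> h" "x \<noteq> y" "0 < \<mu>" "a \<le> \<mu>" "L \<le> b"
  defines "c \<equiv> bb_coeff a b (x - y) (gradient h x - gradient h y)"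
  shows "\<mu> \<le> c" "c \<le> L"
proof -
  note r = bb_quotient_bounds[OF assms(1-3)]
  have "(x - y) \<bullet> (x - y) > 0"
    using assms by simp
  moreover have "0 < ((x - y) \<bullet> (gradient h x - gradient h y)) / ((x - y) \<bullet> (x - y))"
    using r assms by linarith
  ultimately have "(x - y) \<bullet> (gradient h x - gradient h y) > 0"
    by (metis zero_less_divide_iff order_less_asym)
  with r assms show "\<mu> \<le> c" "c \<le> L"
    by (auto simp: c_def bb_coeff_def)
qed

text \<open>The left-hand side is the larger of the two decrease guarantees at a full step: the Armijo
  condition and the descent lemma. The Armijo condition alone does not suffice, as
  \<open>2 * (1 - \<sigma>) * \<kappa>\<close> may exceed 1.\<close>

lemma full_step_decrease:
  fixes A \<delta> \<kappa> \<sigma> :: real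
  assumes "0 \<le> \<delta>" "\<delta> \<le> A" "0 < \<kappa>" "\<kappa> \<le> 1" "0 < \<sigma>" "\<sigma> < 1"
  shows "max (\<sigma> * A) (A - \<delta> / (2 * \<kappa>)) \<ge> 2 * \<sigma> * (1 - \<sigma>) * \<kappa> * (A - \<delta> / 2)"
proof (cases "2 * ((1 - \<sigma>) * \<kappa>) * (A - \<delta> / 2) \<le> A")
  case True
  then have "\<sigma> * (2 * ((1 - \<sigma>) * \<kappa>) * (A - \<delta> / 2)) \<le> \<sigma> * A"
    using assms by (intro mult_left_mono) auto
  then show ?thesis
    by (simp add: mult_ac max.coboundedI1)
next
  \<comment> \<open>Here \<open>\<delta>\<close> is small relative to \<open>A\<close>, so the
    descent-lemma term of the maximum is large enough.\<close>
  case False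
  define q where "q = (1 - \<sigma>) * \<kappa>"
  have q: "0 < q" "q < 1"
    using assms mult_left_le[of \<kappa> "1 - \<sigma>"] le_less_trans[of "(1 - \<sigma>) * \<kappa>" "1 - \<sigma>" 1]
    by (simp_all add: q_def)
  have "\<sigma> * (1 - \<sigma>) \<le> 1 / 4"
    using zero_le_power2[of "\<sigma> - 1 / 2"] by (simp add: power2_eq_square algebra_simps)
  moreover have "\<kappa>\<^sup>2 \<le> 1"
    using assms by (simp add: power_le_one)
  ultimately have "(\<sigma> * (1 - \<sigma>)) * \<kappa>\<^sup>2 \<le> 1 / 4 * 1"
    using assms by (intro mult_mono) auto
  then have "0 \<le> 1 - 2 * ((\<sigma> * (1 - \<sigma>)) * \<kappa>\<^sup>2)"
    by linarith
  then have B: "0 \<le> 1 - 2 * \<sigma> * q * \<kappa>"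
    by (simp add: q_def power2_eq_square mult_ac)
  have \<delta>: "q * \<delta> \<le> (2 * q - 1) * A"
    using False by (simp add: q_def algebra_simps)
  have "(q * \<delta>) * (1 - 2 * \<sigma> * q * \<kappa>) \<le> (2 * q - 1) * A * (1 - 2 * \<sigma> * q * \<kappa>)"
    using \<delta> B by (rule mult_right_mono)
  also have "\<dots> = A * ((2 * \<kappa> - 4 * \<sigma> * q * \<kappa>) * q) - A * (q\<^sup>2 + (1 - q)\<^sup>2)"
    unfolding q_def by (simp add: power2_eq_square algebra_simps)
  also have "\<dots> \<le> A * ((2 * \<kappa> - 4 * \<sigma> * q * \<kappa>) * q)"
    using assms by simp
  finally have "q * (\<delta> * (1 - 2 * \<sigma> * q * \<kappa>)) \<le> q * (A * (2 * \<kappa> - 4 * \<sigma> * q * \<kappa>))"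
    by (simp add: mult_ac)
  then have "\<delta> * (1 - 2 * \<sigma> * q * \<kappa>) \<le> A * (2 * \<kappa> - 4 * \<sigma> * q * \<kappa>)"
    using q by simp
  then have "2 * \<sigma> * q * (A - \<delta> / 2) \<le> A - \<delta> / (2 * \<kappa>)"
    using assms by (simp add: field_simps)
  then show ?thesis
    by (simp add: q_def mult_ac max.coboundedI2)
qed


text \<open>\<open>lsc_fun\<close> speaks of the punctured limit inferior; adding the bound at
  \<open>x\<close> itself allows \<open>X\<close> to take the value \<open>x\<close>.\<close>

lemma lsc_fun_eventually_greater:
  assumes "lsc_fun h" "(X \<longlongrightarrow> x) F" "C < h x"
  shows "\<forall>\<^sub>F n in F. C < h (X n)"
proof -
  have "C < Liminf (at x) h"
    using assms unfolding lsc_fun_def by (meson less_le_trans)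
  then have "\<forall>\<^sub>F y in at x. C < h y"
    by (rule less_LiminfD)
  with assms(3) have "\<forall>\<^sub>F y in nhds x. C < h y"
    by (simp add: eventually_nhds_conv_at)
  then show ?thesis
    using assms(2) by (rule eventually_compose_filterlim)
qed

section \<open>Real-valued form of the problem on the common effective domain\<close>

locale strongly_convex_composite =
  fixes f :: "'m::finite \<Rightarrow> 'a::euclidean_space \<Rightarrow> real"
    and g :: "'m \<Rightarrow> 'a \<Rightarrow> ereal"
    and L \<mu> :: "'m \<Rightarrow> real"
  assumes proper: "\<And>i. proper_fun (g i)"
    and convex: "\<And>i. convex_fun (g i)"
    and smooth: "\<And>i. smooth_with (L i) (f i)"
    and \<mu>_pos: "\<And>i. \<mu> i > 0"
    and strongly_convex: "\<And>i. strongly_convex_with (\<mu> i) (f i)"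
begin

definition fdom :: "'a set" where
  "fdom = {z. \<forall>i. g i z \<noteq> \<infinity>}"

text \<open>\<open>real_of_ereal\<close> maps infinity to 0, so \<open>gr\<close> represents
  \<open>g\<close> only where the latter is finite; hence the recurring hypotheses about
  \<open>fdom\<close>.\<close>

definition gr :: "'m \<Rightarrow> 'a \<Rightarrow> real" where
  "gr i z = real_of_ereal (g i z)"

definition Fr :: "'m \<Rightarrow> 'a \<Rightarrow> real" where
  "Fr i z = f i z + gr i z"

definition lin :: "'m \<Rightarrow> 'a \<Rightarrow> 'a \<Rightarrow> real" where
  "lin i x p = gradient (f i) x \<bullet> (p - x) + gr i p - gr i x"

definition \<kappa> :: real where
  "\<kappa> = (MIN i. \<mu> i / L i)"

lemma g_not_MInf: "g i z \<noteq> -\<infinity>"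
  using proper[of i] by (simp add: proper_fun_def)

lemma g_eq: "z \<in> fdom \<Longrightarrow> g i z = ereal (gr i z)"
  using g_not_MInf[of i z] by (cases "g i z") (auto simp: fdom_def gr_def)

lemma fdomI:
  assumes "\<And>i. g i z \<le> ereal (c i)"
  shows "z \<in> fdom"
proof -
  have "g i z \<noteq> \<infinity>" for i
    using assms[of i] by auto
  then show ?thesis
    by (simp add: fdom_def)
qed

lemma objective_eq: "z \<in> fdom \<Longrightarrow> objective f g i z = ereal (Fr i z)"
  by (simp add: objective_def g_eq Fr_def)

lemma fdom_iff: "z \<in> fdom \<longleftrightarrow> (\<forall>i. objective f g i z \<noteq> \<infinity>)"
  by (auto simp: fdom_def objective_def)

lemma lin_decrease_eq: "x \<in> fdom \<Longrightarrow> p \<in> fdom \<Longrightarrow> lin_decrease f g i x p = ereal (lin i x p)"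
  by (simp add: lin_decrease_def g_eq lin_def)

lemma segment:
  assumes "x \<in> fdom" "y \<in> fdom" "0 \<le> s" "s \<le> 1"
  shows segment_in_fdom: "x + s *\<^sub>R (y - x) \<in> fdom"
    and gr_segment: "gr i (x + s *\<^sub>R (y - x)) \<le> (1 - s) * gr i x + s * gr i y"
proof -
  have eq: "x + s *\<^sub>R (y - x) = (1 - s) *\<^sub>R x + s *\<^sub>R y"
    by (simp add: algebra_simps)
  have *: "g i (x + s *\<^sub>R (y - x)) \<le> ereal ((1 - s) * gr i x + s * gr i y)" for i
    using convex[of i, unfolded convex_fun_def, rule_format, where u = "1 - s" and v = s and x = x and y = y]
      assms by (simp add: eq g_eq)
  show **: "x + s *\<^sub>R (y - x) \<in> fdom"
    using * by (rule fdomI)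
  show "gr i (x + s *\<^sub>R (y - x)) \<le> (1 - s) * gr i x + s * gr i y"
    using *[of i] by (simp add: g_eq[OF **])
qed

text \<open>\<open>lin i x\<close> is convex on \<open>fdom\<close> and vanishes at
  \<open>x\<close>.\<close>

lemma lin_segment:
  assumes "x \<in> fdom" "y \<in> fdom" "0 \<le> s" "s \<le> 1"
  shows "lin i x (x + s *\<^sub>R (y - x)) \<le> s * lin i x y"
  using gr_segment[OF assms, of i] by (simp add: lin_def algebra_simps)

lemma Fr_lower_bound: "Fr i y \<ge> Fr i x + lin i x y + \<mu> i / 2 * (norm (y - x))\<^sup>2"
  using strongly_convex_lower_bound[OF strongly_convex, of i x y] by (simp add: Fr_def lin_def)

lemma Fr_segment_upper_bound:
  assumes "x \<in> fdom" "y \<in> fdom" "0 \<le> s" "s \<le> 1"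
  shows "Fr i (x + s *\<^sub>R (y - x)) \<le> Fr i x + s * lin i x y + L i / 2 * s\<^sup>2 * (norm (y - x))\<^sup>2"
proof -
  have "f i (x + s *\<^sub>R (y - x)) \<le>
      f i x + s * (gradient (f i) x \<bullet> (y - x)) + L i / 2 * s\<^sup>2 * (norm (y - x))\<^sup>2"
    using smooth_upper_bound[OF smooth, of i "x + s *\<^sub>R (y - x)" x]
    by (simp add: power_mult_distrib)
  with gr_segment[OF assms, of i] show ?thesis
    unfolding Fr_def lin_def by (simp add: algebra_simps)
qed

lemma Fr_midpoint:
  assumes "x \<in> fdom" "y \<in> fdom"
  shows "midpoint x y \<in> fdom"
    and "Fr i (midpoint x y) \<le> (Fr i x + Fr i y) / 2 - \<mu> i / 8 * (norm (y - x))\<^sup>2"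
proof -
  have eq: "midpoint x y = x + (1 / 2) *\<^sub>R (y - x)"
    by (simp add: midpoint_def algebra_simps flip: scaleR_add_left)
  show "midpoint x y \<in> fdom"
    unfolding eq using assms by (intro segment_in_fdom) auto
  have "gr i (midpoint x y) \<le> (gr i x + gr i y) / 2"
    unfolding eq using gr_segment[OF assms, of "1 / 2" i] by (simp add: field_simps)
  then show "Fr i (midpoint x y) \<le> (Fr i x + Fr i y) / 2 - \<mu> i / 8 * (norm (y - x))\<^sup>2"
    using strongly_convex_midpoint[OF strongly_convex, of i x y] by (simp add: Fr_def field_simps)
qed

text \<open>Both constants bound the same quotient, taken at a basis vector and the origin.\<close>

lemma \<mu>_le_L: "\<mu> i \<le> L i"
proof -
  obtain b :: 'a where "b \<in> Basis"
    using nonempty_Basis by blast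
  then have "b \<noteq> 0"
    by auto
  from bb_quotient_bounds[OF smooth strongly_convex this, of i] show ?thesis
    by linarith
qed

lemma \<kappa>_pos: "0 < \<kappa>" and \<kappa>_le_1: "\<kappa> \<le> 1" and \<kappa>_L_le: "\<kappa> * L i \<le> \<mu> i"
proof -
  have L: "L i > 0" for i
    using \<mu>_pos[of i] \<mu>_le_L[of i] by linarith
  then show "0 < \<kappa>"
    by (auto simp: \<kappa>_def \<mu>_pos)
  have le: "\<kappa> \<le> \<mu> i / L i" for i
    unfolding \<kappa>_def by (rule Min_le) auto
  then show "\<kappa> * L i \<le> \<mu> i"
    using L by (simp add: pos_le_divide_eq)
  \<comment> \<open>\<open>undefined\<close> serves as an arbitrary index.\<close>
  have "\<kappa> \<le> \<mu> undefined / L undefined"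
    by (rule le)
  also have "\<dots> \<le> 1"
    using L \<mu>_le_L by (simp add: divide_le_eq)
  finally show "\<kappa> \<le> 1" .
qed

section \<open>The merit function\<close>

text \<open>A point \<open>y\<close> outside \<open>fdom\<close> has an infinite objective, which
  makes the inner minimum \<open>-\<infinity>\<close>; so the supremum is governed by
  \<open>fdom\<close>, where everything is real.\<close>

lemma merit_le_iff:
  assumes "x \<in> fdom"
  shows "merit \<mu> (objective f g) x \<le> ereal c \<longleftrightarrow> (\<forall>y\<in>fdom. \<exists>i. Fr i x - Fr i y \<le> \<mu> i * c)"
proof -
  have "(\<exists>i. (objective f g i x - objective f g i y) / ereal (\<mu> i) \<le> ereal c) \<longleftrightarrow>
      (y \<in> fdom \<longrightarrow> (\<exists>i. Fr i x - Fr i y \<le> \<mu> i * c))" for y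
  proof (cases "y \<in> fdom")
    case True
    have "(objective f g i x - objective f g i y) / ereal (\<mu> i) \<le> ereal c \<longleftrightarrow>
        Fr i x - Fr i y \<le> \<mu> i * c" for i
      using \<mu>_pos[of i] by (simp add: objective_eq assms True divide_le_eq mult.commute)
    with True show ?thesis
      by simp
  next
    case False
    then obtain i where "objective f g i y = \<infinity>"
      by (auto simp: fdom_iff)
    then have "(objective f g i x - objective f g i y) / ereal (\<mu> i) = -\<infinity>"
      using \<mu>_pos[of i] by (simp add: objective_eq assms)
    with False show ?thesis
      by (metis ereal_less_eq(2))
  qed
  then show ?thesis
    by (simp add: merit_def SUP_le_iff Min_le_iff Ball_def)
qed

lemma merit_nonneg:
  assumes "x \<in> fdom"
  shows "0 \<le> merit \<mu> (objective f g) x"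
proof -
  have "0 = (MIN i. (objective f g i x - objective f g i x) / ereal (\<mu> i))"
    by (simp add: objective_eq assms)
  also have "\<dots> \<le> merit \<mu> (objective f g) x"
    unfolding merit_def by (rule SUP_upper) simp
  finally show ?thesis .
qed

section \<open>The proximal subproblem and its optimal value\<close>

lemma subproblem_le_iff:
  assumes "x \<in> fdom" "\<And>i. \<alpha> i > 0"
  shows "subproblem f g \<alpha> x p \<le> ereal c \<longleftrightarrow>
    p \<in> fdom \<and> (\<forall>i. lin i x p \<le> \<alpha> i * (c - 1 / 2 * (norm (p - x))\<^sup>2))"
proof (cases "p \<in> fdom")
  case True
  have "lin_decrease f g i x p / ereal (\<alpha> i) + ereal r \<le> ereal c \<longleftrightarrow> lin i x p \<le> \<alpha> i * (c - r)"
    for i r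
    using assms(2)[of i] by (simp add: lin_decrease_eq assms(1) True field_simps)
  then show ?thesis
    using True by (simp add: subproblem_def del: plus_ereal.simps)
next
  case False
  then obtain i where "g i p = \<infinity>"
    by (auto simp: fdom_def)
  then have "\<infinity> = lin_decrease f g i x p / ereal (\<alpha> i) + ereal (1 / 2 * (norm (p - x))\<^sup>2)"
    using assms(2)[of i] by (simp add: lin_decrease_def g_eq[OF assms(1)])
  then have "\<infinity> \<le> subproblem f g \<alpha> x p"
    unfolding subproblem_def by (intro Max_ge range_eqI) simp_all
  with False show ?thesis
    by simp
qed

lemma subproblem_not_MInf:
  assumes "x \<in> fdom" "\<And>i. \<alpha> i > 0"
  shows "subproblem f g \<alpha> x p \<noteq> -\<infinity>"
proof
  assume *: "subproblem f g \<alpha> x p = -\<infinity>"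
  then have "subproblem f g \<alpha> x p \<le> ereal c" for c
    by simp
  then have le: "lin undefined x p \<le> \<alpha> undefined * (c - 1 / 2 * (norm (p - x))\<^sup>2)" for c
    using subproblem_le_iff[of x \<alpha>, OF assms] by blast
  \<comment> \<open>The chosen \<open>c\<close> turns the right-hand side into
    \<open>lin undefined x p - 1\<close>.\<close>
  show False
    using le[of "1 / 2 * (norm (p - x))\<^sup>2 + (lin undefined x p - 1) / \<alpha> undefined"] assms(2)[of undefined]
    by simp
qed

text \<open>The number \<open>- v\<close> is the optimal value of the subproblem.\<close>

lemma subproblem_minimizer:
  assumes x: "x \<in> fdom" and \<alpha>: "\<And>i. \<mu> i \<le> \<alpha> i" "\<And>i. \<alpha> i \<le> L i"
    and min: "is_arg_min (subproblem f g \<alpha> x) (\<lambda>_. True) (x + d)"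
  obtains v where "x + d \<in> fdom"
    and "\<And>i. lin i x (x + d) \<le> - \<alpha> i * (v + (norm d)\<^sup>2 / 2)"
    and "(norm d)\<^sup>2 \<le> v + (norm d)\<^sup>2 / 2"
    and "merit \<mu> (objective f g) x \<le> ereal (v / \<kappa>\<^sup>2)"
proof -
  have \<alpha>_pos: "\<alpha> i > 0" for i
    using \<mu>_pos[of i] \<alpha>(1)[of i] by linarith
  note le_iff = subproblem_le_iff[of x \<alpha>, OF x \<alpha>_pos]
  let ?S = "subproblem f g \<alpha> x"
  have min': "?S (x + d) \<le> ?S p" for p
    using min by (auto simp: is_arg_min_def not_less)
  have "?S x \<le> ereal 0"
    unfolding le_iff using x by (simp add: lin_def)
  then have "?S (x + d) \<le> ereal 0"
    using min' order_trans by blast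
  then obtain \<theta> where \<theta>: "?S (x + d) = ereal \<theta>" "\<theta> \<le> 0"
    using subproblem_not_MInf[of x \<alpha> "x + d", OF x \<alpha>_pos] by (cases "?S (x + d)") auto
  have opt: "\<theta> \<le> c" if "p \<in> fdom" "\<And>i. lin i x p \<le> \<alpha> i * (c - 1 / 2 * (norm (p - x))\<^sup>2)" for c p
    using le_iff[of p c] min'[of p] that \<theta> by (metis ereal_less_eq(3) order_trans)
  have d_fdom: "x + d \<in> fdom" and lin_d: "lin i x (x + d) \<le> \<alpha> i * (\<theta> - 1 / 2 * (norm d)\<^sup>2)" for i
    using le_iff[of "x + d" \<theta>] \<theta> by auto
  define v where "v = - \<theta>"
  define A where "A = v + (norm d)\<^sup>2 / 2"
  define \<delta> where "\<delta> = (norm d)\<^sup>2"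
  have A: "lin i x (x + d) \<le> - \<alpha> i * A" for i
    using lin_d[of i] by (simp add: A_def v_def algebra_simps)
  \<comment> \<open>Minimality is tested against \<open>x + s *\<^sub>R d\<close>. At
    \<open>s = 1\<close> this is trivial, so a factor \<open>1 - s\<close> is cancelled first and
    \<open>s\<close> tends to 1 afterwards, giving \<open>\<delta> \<le> A\<close>.\<close>
  have half: "(1 + s) / 2 * \<delta> \<le> A" if "0 \<le> s" "s < 1" for s
  proof -
    have "lin i x (x + s *\<^sub>R d) \<le> \<alpha> i * ((s\<^sup>2 / 2 * \<delta> - s * A) - 1 / 2 * (norm (s *\<^sub>R d))\<^sup>2)" for i
    proof -
      have "lin i x (x + s *\<^sub>R d) \<le> s * lin i x (x + d)"
        using lin_segment[OF x d_fdom, of s i] that by simp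
      also have "\<dots> \<le> s * (- \<alpha> i * A)"
        using A that by (intro mult_left_mono)
      finally show ?thesis
        by (simp add: \<delta>_def power_mult_distrib algebra_simps)
    qed
    moreover have "x + s *\<^sub>R d \<in> fdom"
      using segment_in_fdom[OF x d_fdom, of s] that by simp
    ultimately have "\<theta> \<le> s\<^sup>2 / 2 * \<delta> - s * A"
      by (intro opt[of "x + s *\<^sub>R d"]) auto
    then have "(1 - s) * ((1 + s) / 2 * \<delta>) \<le> (1 - s) * A"
      by (simp add: A_def v_def \<delta>_def power2_eq_square field_simps)
    with that show ?thesis
      by simp
  qed
  have "\<delta> \<le> A"
  proof (rule tendsto_upperbound[of "\<lambda>s. (1 + s) / 2 * \<delta>" _ "at_left (1::real)"])
    show "((\<lambda>s. (1 + s) / 2 * \<delta>) \<longlongrightarrow> \<delta>) (at_left 1)"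
      by (auto intro!: tendsto_eq_intros)
    show "\<forall>\<^sub>F s in at_left 1. (1 + s) / 2 * \<delta> \<le> A"
      by (rule eventually_mono[OF eventually_at_left_real[OF zero_less_one]]) (use half in auto)
  qed simp
  moreover have "merit \<mu> (objective f g) x \<le> ereal (v / \<kappa>\<^sup>2)"
    unfolding merit_le_iff[OF x]
  proof
    fix y assume y: "y \<in> fdom"
    define c where "c = (MIN i. (Fr i x - Fr i y) / \<mu> i)"
    have "c \<in> range (\<lambda>i. (Fr i x - Fr i y) / \<mu> i)"
      unfolding c_def by (rule Min_in) auto
    then obtain j where "c = (Fr j x - Fr j y) / \<mu> j"
      by blast
    then have j: "Fr j x - Fr j y = \<mu> j * c"
      using \<mu>_pos[of j] by simp
    have c: "\<mu> i * c \<le> Fr i x - Fr i y" for i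
      using \<mu>_pos[of i] Min_le[of "range (\<lambda>i. (Fr i x - Fr i y) / \<mu> i)" "(Fr i x - Fr i y) / \<mu> i"]
      by (simp add: c_def pos_le_divide_eq mult.commute)
    have "\<kappa>\<^sup>2 * c \<le> v"
    proof (cases "c \<le> 0")
      case True
      then have "\<kappa>\<^sup>2 * c \<le> 0"
        by (simp add: mult_nonneg_nonpos)
      with \<theta> show ?thesis
        by (simp add: v_def)
    next
      case False
      define N where "N = (norm (y - x))\<^sup>2"
      \<comment> \<open>Strong convexity bounds \<open>lin i x y\<close> by
        \<open>- \<mu> i * (c + N / 2)\<close>. Shrinking by \<open>\<kappa>\<close> and using
        \<open>\<kappa> * \<alpha> i \<le> \<mu> i\<close> gives
        \<open>- \<alpha> i * \<kappa>\<^sup>2 * (c + N / 2)\<close>, whose \<open>N\<close> part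
        exactly pays for the proximal term at \<open>?p\<close>.\<close>
      let ?p = "x + \<kappa> *\<^sub>R (y - x)"
      have norm_p: "(norm (?p - x))\<^sup>2 = \<kappa>\<^sup>2 * N"
        by (simp add: N_def power_mult_distrib)
      have "lin i x ?p \<le> \<alpha> i * (- (\<kappa>\<^sup>2 * c) - 1 / 2 * (norm (?p - x))\<^sup>2)" for i
      proof -
        have "lin i x ?p \<le> \<kappa> * lin i x y"
          using lin_segment[OF x y] \<kappa>_pos \<kappa>_le_1 by simp
        also have "\<dots> \<le> \<kappa> * (- \<mu> i * (c + N / 2))"
          using Fr_lower_bound[of i x y] c[of i] \<kappa>_pos
          by (intro mult_left_mono) (auto simp: N_def algebra_simps)
        also have "\<dots> \<le> \<kappa> * (- (\<kappa> * \<alpha> i) * (c + N / 2))"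
        proof -
          have "\<kappa> * \<alpha> i \<le> \<mu> i"
            using \<kappa>_L_le[of i] \<alpha>(2)[of i] \<kappa>_pos by (meson mult_left_mono less_imp_le order_trans)
          moreover have "0 \<le> c + N / 2"
            using False by (simp add: N_def)
          ultimately have "(\<kappa> * \<alpha> i) * (c + N / 2) \<le> \<mu> i * (c + N / 2)"
            by (rule mult_right_mono)
          with \<kappa>_pos show ?thesis
            by simp
        qed
        finally show ?thesis
          unfolding norm_p by (simp add: power2_eq_square algebra_simps)
      qed
      moreover have "?p \<in> fdom"
        using segment_in_fdom[OF x y] \<kappa>_pos \<kappa>_le_1 by simp
      ultimately have "\<theta> \<le> - (\<kappa>\<^sup>2 * c)"
        by (intro opt)
      then show ?thesis
        by (simp add: v_def)
    qed
    then have "c \<le> v / \<kappa>\<^sup>2"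
      using \<kappa>_pos by (simp add: pos_le_divide_eq mult.commute)
    then have "\<mu> j * c \<le> \<mu> j * (v / \<kappa>\<^sup>2)"
      using \<mu>_pos[of j] by (intro mult_left_mono) auto
    with j show "\<exists>i. Fr i x - Fr i y \<le> \<mu> i * (v / \<kappa>\<^sup>2)"
      by (intro exI[of _ j]) linarith
  qed
  ultimately show ?thesis
    using that[of v] d_fdom A by (simp add: A_def \<delta>_def)
qed

section \<open>Decrease achieved by the line search\<close>

lemma armijo_iff:
  assumes "x \<in> fdom" "x + d \<in> fdom" "0 \<le> t" "t \<le> 1"
  shows "(\<forall>i. objective f g i (x + t *\<^sub>R d) - objective f g i x
        \<le> ereal (t * \<sigma>) * lin_decrease f g i x (x + d)) \<longleftrightarrow>
    (\<forall>i. Fr i (x + t *\<^sub>R d) - Fr i x \<le> t * \<sigma> * lin i x (x + d))"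
proof -
  have "x + t *\<^sub>R d \<in> fdom"
    using segment_in_fdom[of x "x + d" t] assms by simp
  then show ?thesis
    using assms by (simp add: objective_eq lin_decrease_eq)
qed

text \<open>The bound in \<open>v\<close> drives the merit function down; the bound in the squared
  step length makes the steps summable. A step below 1 is controlled through the last rejected trial
  step.\<close>

lemma bbpgmo_step_decrease:
  assumes step: "bbpgmo_step \<sigma> \<gamma> \<alpha>min \<alpha>max f g xp x xn"
    and x: "x \<in> fdom" "xp \<noteq> x"
    and par: "0 < \<sigma>" "\<sigma> < 1" "0 < \<gamma>" "\<gamma> < 1"
    and \<alpha>b: "\<And>i. \<alpha>min \<le> \<mu> i" "\<And>i. L i \<le> \<alpha>max"
  obtains v where "xn \<in> fdom" "xn \<noteq> x"
    and "\<And>i. \<mu> i * (2 * \<gamma> * \<sigma> * (1 - \<sigma>) * \<kappa> * v) \<le> Fr i x - Fr i xn"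
    and "\<And>i. \<mu> i * (\<sigma> * (norm (xn - x))\<^sup>2) \<le> Fr i x - Fr i xn"
    and "merit \<mu> (objective f g) x \<le> ereal (v / \<kappa>\<^sup>2)"
proof -
  obtain \<alpha> d t where \<alpha>_eq: "\<And>i. \<alpha> i = bb_coeff \<alpha>min \<alpha>max (x - xp) (gradient (f i) x - gradient (f i) xp)"
    and min: "is_arg_min (subproblem f g \<alpha> x) (\<lambda>_. True) (x + d)"
    and d: "d \<noteq> 0" and t: "t \<in> armijo_steps \<sigma> \<gamma> f g x d"
    and t_max: "\<And>s. s \<in> armijo_steps \<sigma> \<gamma> f g x d \<Longrightarrow> s \<le> t"
    and xn: "xn = x + t *\<^sub>R d"
    using step unfolding bbpgmo_step_def by blast
  have \<alpha>: "\<mu> i \<le> \<alpha> i" "\<alpha> i \<le> L i" for i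
    unfolding \<alpha>_eq using bb_coeff_bounds[OF smooth strongly_convex x(2)[symmetric] \<mu>_pos] \<alpha>b by blast+
  obtain v where d_fdom: "x + d \<in> fdom"
    and lin_d: "\<And>i. lin i x (x + d) \<le> - \<alpha> i * (v + (norm d)\<^sup>2 / 2)"
    and v: "(norm d)\<^sup>2 \<le> v + (norm d)\<^sup>2 / 2"
    and merit: "merit \<mu> (objective f g) x \<le> ereal (v / \<kappa>\<^sup>2)"
    using subproblem_minimizer[OF x(1) \<alpha> min] by blast
  define \<delta> A where "\<delta> = (norm d)\<^sup>2" and "A = v + \<delta> / 2"
  have "0 < \<delta>"
    using d by (simp add: \<delta>_def)
  moreover have "\<delta> \<le> A"
    using v by (simp add: A_def \<delta>_def)
  ultimately have A: "0 \<le> \<delta>" "\<delta> \<le> A" "0 < A"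
    by linarith+
  have lin_A: "lin i x (x + d) \<le> - \<alpha> i * A" for i
    using lin_d[of i] by (simp add: A_def \<delta>_def)
  have lin_\<mu>: "lin i x (x + d) \<le> - \<mu> i * A" for i
    using lin_A[of i] mult_right_mono[OF \<alpha>(1)[of i], of A] A by linarith
  obtain j where j: "t = \<gamma> ^ j"
    using t unfolding armijo_steps_def by blast
  then have t01: "0 < t" "t \<le> 1"
    using par by (simp_all add: power_le_one)
  have armijo: "Fr i xn - Fr i x \<le> t * \<sigma> * lin i x (x + d)" for i
    using t armijo_iff[OF x(1) d_fdom, of t \<sigma>] t01 unfolding armijo_steps_def xn by auto
  have D_armijo: "\<mu> i * (t * \<sigma> * A) \<le> Fr i x - Fr i xn" for i
  proof -
    have "t * \<sigma> * lin i x (x + d) \<le> t * \<sigma> * (- \<mu> i * A)"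
      using lin_\<mu>[of i] par t01 by (intro mult_left_mono) auto
    with armijo[of i] show ?thesis
      by (simp add: algebra_simps)
  qed
  have upper: "Fr i (x + s *\<^sub>R d) \<le> Fr i x + s * lin i x (x + d) + L i / 2 * s\<^sup>2 * \<delta>"
    if "0 \<le> s" "s \<le> 1" for s i
    using Fr_segment_upper_bound[OF x(1) d_fdom that, of i] by (simp add: \<delta>_def)
  show ?thesis
  proof (rule that)
    show "xn \<in> fdom"
      using segment_in_fdom[OF x(1) d_fdom, of t] t01 by (simp add: xn)
    show "xn \<noteq> x"
      using d t01 by (simp add: xn)
    show "merit \<mu> (objective f g) x \<le> ereal (v / \<kappa>\<^sup>2)"
      by (rule merit)
    show "\<mu> i * (\<sigma> * (norm (xn - x))\<^sup>2) \<le> Fr i x - Fr i xn" for i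
    proof -
      have "(norm (xn - x))\<^sup>2 = t * (t * \<delta>)"
        using t01 by (simp add: xn \<delta>_def power2_eq_square)
      also have "\<dots> \<le> t * (1 * A)"
        using t01 A by (intro mult_left_mono mult_mono) auto
      finally have "\<mu> i * (\<sigma> * (norm (xn - x))\<^sup>2) \<le> \<mu> i * (\<sigma> * (t * A))"
        using par \<mu>_pos[of i] by (intro mult_left_mono) auto
      with D_armijo[of i] show ?thesis
        by (simp add: mult_ac)
    qed
    show "\<mu> i * (2 * \<gamma> * \<sigma> * (1 - \<sigma>) * \<kappa> * v) \<le> Fr i x - Fr i xn" for i
    proof -
      have v_nonneg: "0 \<le> v" and v_le: "v \<le> A" and v_eq: "v = A - \<delta> / 2"
        using A by (auto simp: A_def)
      \<comment> \<open>After backtracking, the Armijo decrease alone suffices; for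
        \<open>t = 1\<close> it may have to be replaced by the descent-lemma decrease.\<close>
      have "2 * \<gamma> * \<sigma> * (1 - \<sigma>) * \<kappa> * v \<le> t * \<sigma> * A \<or>
          t = 1 \<and> 2 * \<gamma> * \<sigma> * (1 - \<sigma>) * \<kappa> * v \<le> max (\<sigma> * A) (A - \<delta> / (2 * \<kappa>))"
      proof (cases j)
        case 0
        have "\<gamma> * (2 * \<sigma> * (1 - \<sigma>) * \<kappa> * v) \<le> 1 * (2 * \<sigma> * (1 - \<sigma>) * \<kappa> * v)"
          using par \<kappa>_pos v_nonneg by (intro mult_right_mono) auto
        with full_step_decrease[OF A(1,2) \<kappa>_pos \<kappa>_le_1 par(1,2)] show ?thesis
          by (simp add: j 0 v_eq mult_ac)
      next
        case (Suc l)
        define s where "s = \<gamma> ^ l"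
        have s: "0 < s" "s \<le> 1" "t = \<gamma> * s" "t < s"
          \<comment> \<open>The trial step \<open>s = t / \<gamma>\<close> exceeds the largest
            accepted one, so it violates the Armijo condition for some index; comparison with the
            descent lemma there forces \<open>2 * (1 - \<sigma>) * \<kappa> \<le> s\<close>.\<close>
          using par t01 by (auto simp: s_def power_le_one j Suc)
        have "s \<notin> armijo_steps \<sigma> \<gamma> f g x d"
          using t_max[of s] s(4) by auto
        moreover have "\<exists>l. s = \<gamma> ^ l"
          by (auto simp: s_def)
        ultimately have "\<not> (\<forall>i. objective f g i (x + s *\<^sub>R d) - objective f g i x
            \<le> ereal (s * \<sigma>) * lin_decrease f g i x (x + d))"
          unfolding armijo_steps_def by blast
        then obtain i where i: "s * \<sigma> * lin i x (x + d) < Fr i (x + s *\<^sub>R d) - Fr i x"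
          unfolding armijo_iff[OF x(1) d_fdom less_imp_le[OF s(1)] s(2)] by (auto simp: not_le)
        have "s * ((1 - \<sigma>) * (\<alpha> i * A)) < s * (L i / 2 * s * \<delta>)"
        proof -
          have "s * (1 - \<sigma>) * lin i x (x + d) \<le> s * (1 - \<sigma>) * (- \<alpha> i * A)"
            using lin_A[of i] s par by (intro mult_left_mono) auto
          with i upper[of s i] s show ?thesis
            by (simp add: power2_eq_square algebra_simps)
        qed
        then have "(1 - \<sigma>) * (\<alpha> i * A) < L i / 2 * s * \<delta>"
          using s by simp
        also have "\<dots> \<le> L i / 2 * s * A"
          using A s \<mu>_pos[of i] \<mu>_le_L[of i] by (intro mult_left_mono) auto
        finally have "((1 - \<sigma>) * \<alpha> i) * A < (L i / 2 * s) * A"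
          by (simp add: mult_ac)
        then have "(1 - \<sigma>) * \<alpha> i < L i / 2 * s"
          using A by (simp add: mult_less_cancel_right)
        moreover have "(1 - \<sigma>) * (\<kappa> * L i) \<le> (1 - \<sigma>) * \<alpha> i"
          using \<kappa>_L_le[of i] \<alpha>(1)[of i] par by (intro mult_left_mono) auto
        ultimately have "L i * (2 * (1 - \<sigma>) * \<kappa>) < L i * s"
          by (simp add: algebra_simps)
        then have "2 * (1 - \<sigma>) * \<kappa> \<le> s"
          using \<mu>_pos[of i] \<mu>_le_L[of i] by simp
        then have "(\<gamma> * \<sigma>) * (2 * (1 - \<sigma>) * \<kappa>) \<le> (\<gamma> * \<sigma>) * s"
          using par by (intro mult_left_mono) auto
        then have "(\<gamma> * \<sigma>) * (2 * (1 - \<sigma>) * \<kappa>) * v \<le> (\<gamma> * \<sigma>) * s * A"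
          using v_le v_nonneg par s by - (rule mult_mono, auto)
        then show ?thesis
          by (simp add: s mult_ac)
      qed
      \<comment> \<open>For the full step the descent lemma applies, with \<open>L i\<close>
        replaced by the larger \<open>\<mu> i / \<kappa>\<close>.\<close>
      moreover have "\<mu> i * (A - \<delta> / (2 * \<kappa>)) \<le> Fr i x - Fr i xn" if "t = 1"
      proof -
        have "L i \<le> \<mu> i / \<kappa>"
          using \<kappa>_L_le[of i] \<kappa>_pos by (simp add: pos_le_divide_eq mult.commute)
        then have "L i * (\<delta> / 2) \<le> \<mu> i / \<kappa> * (\<delta> / 2)"
          using A by (intro mult_right_mono) auto
        with upper[of 1 i] lin_\<mu>[of i] that show ?thesis
          by (simp add: xn algebra_simps)
      qed
      ultimately show ?thesis
        using D_armijo[of i] \<mu>_pos[of i]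
        by (auto simp: max_def split: if_splits
            intro: order_trans[OF mult_left_mono[of _ _ "\<mu> i"]])
    qed
  qed
qed

section \<open>Linear decay of the merit function\<close>

text \<open>If \<open>u\<close> is the merit value at \<open>x\<close>, a uniform decrease of all
  scaled objectives by \<open>\<rho> * v\<close> lowers the merit to at most
  \<open>u - \<rho> * v\<close>, and \<open>v\<close> is at least
  \<open>\<kappa>\<^sup>2 * u\<close>.\<close>

lemma merit_decrease:
  assumes x: "x \<in> fdom" and xn: "xn \<in> fdom" and "0 \<le> \<rho>"
    and decr: "\<And>i. \<mu> i * (\<rho> * v) \<le> Fr i x - Fr i xn"
    and merit: "merit \<mu> (objective f g) x \<le> ereal (v / \<kappa>\<^sup>2)"
  shows "merit \<mu> (objective f g) xn \<le> ereal (1 - \<rho> * \<kappa>\<^sup>2) * merit \<mu> (objective f g) x"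
proof -
  obtain u where u: "merit \<mu> (objective f g) x = ereal u"
    using merit_nonneg[OF x] merit by (cases "merit \<mu> (objective f g) x") auto
  have "u \<le> v / \<kappa>\<^sup>2"
    using merit u by simp
  then have "\<rho> * (u * \<kappa>\<^sup>2) \<le> \<rho> * v"
    using \<kappa>_pos \<open>0 \<le> \<rho>\<close> by (intro mult_left_mono) (auto simp: pos_le_divide_eq)
  then have le: "\<mu> i * (u - \<rho> * v) \<le> \<mu> i * ((1 - \<rho> * \<kappa>\<^sup>2) * u)" for i
    using \<mu>_pos[of i] by (intro mult_left_mono) (auto simp: algebra_simps)
  have "merit \<mu> (objective f g) xn \<le> ereal ((1 - \<rho> * \<kappa>\<^sup>2) * u)"
    unfolding merit_le_iff[OF xn]
  proof
    fix y assume "y \<in> fdom"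
    then obtain i where "Fr i x - Fr i y \<le> \<mu> i * u"
      using merit_le_iff[OF x, of u] u by auto
    with decr[of i] le[of i] show "\<exists>i. Fr i xn - Fr i y \<le> \<mu> i * ((1 - \<rho> * \<kappa>\<^sup>2) * u)"
      by (intro exI[of _ i]) (simp add: algebra_simps)
  qed
  then show ?thesis
    by (simp add: u)
qed


section \<open>Convergence of the iterates and optimality of the limit\<close>

lemma tendsto_imp_Fr_le:
  assumes lsc: "\<And>i. lsc_fun (g i)"
    and X: "X \<longlonglongrightarrow> xs" and X_fdom: "\<And>k. X k \<in> fdom"
    and le: "\<And>i k. n \<le> k \<Longrightarrow> Fr i (X k) \<le> b i"
  shows "xs \<in> fdom" "Fr i xs \<le> b i"
proof -
  have *: "g i xs \<le> ereal (b i - f i xs)" for i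
  proof (rule ccontr)
    assume "\<not> g i xs \<le> ereal (b i - f i xs)"
    \<comment> \<open>\<open>C\<close> splits the bound: eventually \<open>g i\<close> exceeds
      \<open>C\<close> and \<open>f i\<close> exceeds \<open>b i - C\<close>, contradicting the
      bound on their sum.\<close>
    then obtain C where C: "b i - f i xs < C" "ereal C < g i xs"
      using ereal_dense2[of "ereal (b i - f i xs)" "g i xs"] by (auto simp: not_le)
    have "\<forall>\<^sub>F k in sequentially. ereal C < g i (X k)"
      by (rule lsc_fun_eventually_greater[OF lsc X C(2)])
    moreover have "(\<lambda>k. f i (X k)) \<longlonglongrightarrow> f i xs"
      using smooth[of i] X unfolding smooth_with_def
      by (intro isCont_tendsto_compose[of _ "f i"] differentiable_imp_continuous_within) auto
    then have "\<forall>\<^sub>F k in sequentially. b i - C < f i (X k)"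
      using C(1) by (intro order_tendstoD) auto
    ultimately have "\<forall>\<^sub>F k in sequentially. False"
      using eventually_ge_at_top[of n]
    proof eventually_elim
      case (elim k)
      with le[of k i] show ?case
        by (simp add: g_eq[OF X_fdom] Fr_def)
    qed
    then show False
      by simp
  qed
  show **: "xs \<in> fdom"
    using * by (rule fdomI)
  show "Fr i xs \<le> b i"
    using *[of i] by (simp add: g_eq[OF **] Fr_def)
qed

text \<open>If \<open>y\<close> dominated \<open>xs\<close>, their midpoint would improve every
  scaled objective by a fixed positive amount, which small merit values forbid. Merit is measured at
  points \<open>x\<close> no better than \<open>xs\<close>, so that iterates can be used.\<close>

lemma pareto_solutionI:
  assumes xs: "xs \<in> fdom"
    and merit: "\<And>\<epsilon>. \<epsilon> > 0 \<Longrightarrow> \<exists>x\<in>fdom. (\<forall>i. Fr i xs \<le> Fr i x) \<and> merit \<mu> (objective f g) x < ereal \<epsilon>"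
  shows "pareto_solution (objective f g) xs"
  unfolding pareto_solution_def
proof (intro conjI notI)
  show "\<forall>i. \<bar>objective f g i xs\<bar> \<noteq> \<infinity>"
    by (simp add: objective_eq[OF xs])
  assume "\<exists>y. (\<forall>i. objective f g i y \<le> objective f g i xs) \<and>
    (\<exists>i. objective f g i y \<noteq> objective f g i xs)"
  then obtain y where le: "\<And>i. objective f g i y \<le> objective f g i xs" and "y \<noteq> xs"
    by auto
  have y: "y \<in> fdom"
    using le unfolding fdom_iff objective_eq[OF xs]
    by (metis ereal_infty_less_eq(1) PInfty_neq_ereal(1))
  \<comment> \<open>The gain of the midpoint estimate, divided by \<open>\<mu> i\<close>.\<close>
  define \<epsilon> where "\<epsilon> = (norm (y - xs))\<^sup>2 / 8"
  have "\<epsilon> > 0"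
    using \<open>y \<noteq> xs\<close> by (simp add: \<epsilon>_def)
  then obtain x where x: "x \<in> fdom" "\<And>i. Fr i xs \<le> Fr i x" "merit \<mu> (objective f g) x < ereal \<epsilon>"
    using merit by blast
  then obtain c where c: "merit \<mu> (objective f g) x \<le> ereal c" "c < \<epsilon>"
    by (metis ereal_dense2 less_ereal.simps(1) less_imp_le)
  then obtain i where i: "Fr i x - Fr i (midpoint xs y) \<le> \<mu> i * c"
    using merit_le_iff[OF x(1)] Fr_midpoint(1)[OF xs y] by blast
  have "Fr i y \<le> Fr i xs"
    using le[of i] by (simp add: objective_eq xs y)
  then have "\<mu> i * \<epsilon> \<le> \<mu> i * c"
    using i Fr_midpoint(2)[OF xs y, of i] x(2)[of i] by (simp add: \<epsilon>_def field_simps)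
  with c \<mu>_pos[of i] show False
    by simp
qed

lemma tendsto_pareto_solution:
  assumes lsc: "\<And>i. lsc_fun (g i)"
    and X_fdom: "\<And>k. X k \<in> fdom"
    and "0 < \<sigma>"
    and decr: "\<And>i k. \<mu> i * (\<sigma> * (norm (X (Suc k) - X k))\<^sup>2) \<le> Fr i (X k) - Fr i (X (Suc k))"
    and "0 \<le> c" "c < 1"
    and merit: "\<And>k. merit \<mu> (objective f g) (X (Suc k)) \<le> ereal c * merit \<mu> (objective f g) (X k)"
    and merit_0: "merit \<mu> (objective f g) (X 0) \<le> ereal M"
  obtains xs where "X \<longlonglongrightarrow> xs" "pareto_solution (objective f g) xs"
proof -
  have rate: "merit \<mu> (objective f g) (X k) \<le> ereal (c ^ k * M)" for k
  proof (induction k)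
    case (Suc k)
    have "ereal c * merit \<mu> (objective f g) (X k) \<le> ereal c * ereal (c ^ k * M)"
      using Suc \<open>0 \<le> c\<close> by (intro ereal_mult_left_mono) auto
    with merit[of k] show ?case
      by (simp add: mult_ac)
  qed (use merit_0 in simp)
  have step: "norm (X (Suc k) - X k) \<le> sqrt (M / \<sigma>) * sqrt c ^ k" for k
  proof -
    \<comment> \<open>The next iterate is itself a competitor in the merit function, so in some
      component the decrease is at most the scaled merit value. Only one component is needed, as
      \<open>decr\<close> holds for all.\<close>
    obtain i where "Fr i (X k) - Fr i (X (Suc k)) \<le> \<mu> i * (c ^ k * M)"
      using rate[of k] merit_le_iff[OF X_fdom] X_fdom by blast
    then have "\<mu> i * (\<sigma> * (norm (X (Suc k) - X k))\<^sup>2) \<le> \<mu> i * (c ^ k * M)"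
      using decr[of i k] by linarith
    then have "(norm (X (Suc k) - X k))\<^sup>2 \<le> M / \<sigma> * c ^ k"
      using \<mu>_pos[of i] \<open>0 < \<sigma>\<close> by (simp add: field_simps)
    then show ?thesis
      using real_le_rsqrt[of "norm (X (Suc k) - X k)" "M / \<sigma> * c ^ k"]
      by (simp only: real_sqrt_mult real_sqrt_power)
  qed
  have summable: "summable (\<lambda>k. sqrt (M / \<sigma>) * sqrt c ^ k)"
    using \<open>0 \<le> c\<close> \<open>c < 1\<close> by (intro summable_mult summable_geometric) simp
  have "summable (\<lambda>k. X (Suc k) - X k)"
    by (rule summable_comparison_test'[OF summable, of 0]) (rule step)
  then have "(\<lambda>n. X 0 + (\<Sum>k<n. X (Suc k) - X k)) \<longlonglongrightarrow> X 0 + (\<Sum>k. X (Suc k) - X k)"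
    by (intro tendsto_add tendsto_const summable_LIMSEQ)
  then obtain xs where xs: "X \<longlonglongrightarrow> xs"
    unfolding sum_lessThan_telescope by auto
  have "decseq (\<lambda>k. Fr i (X k))" for i
  proof (rule decseq_SucI)
    fix k
    have "0 \<le> \<mu> i * (\<sigma> * (norm (X (Suc k) - X k))\<^sup>2)"
      using \<mu>_pos[of i] \<open>0 < \<sigma>\<close> by simp
    with decr[of i k] show "Fr i (X (Suc k)) \<le> Fr i (X k)"
      by linarith
  qed
  then have le: "Fr i (X k) \<le> Fr i (X n)" if "n \<le> k" for i n k
    using that by (simp add: decseq_def)
  \<comment> \<open>Taking the value at each \<open>X n\<close> as the bound from \<open>n\<close>
    onwards shows that the limit is no worse than any iterate.\<close>
  note xs_le = tendsto_imp_Fr_le[OF lsc xs X_fdom, where b = "\<lambda>i. Fr i (X n)" and n = n for n, OF le]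
  have "pareto_solution (objective f g) xs"
  proof (rule pareto_solutionI)
    show "xs \<in> fdom"
      by (rule xs_le(1))
    fix \<epsilon> :: real assume "\<epsilon> > 0"
    have "(\<lambda>k. c ^ k * M) \<longlonglongrightarrow> 0"
      using \<open>0 \<le> c\<close> \<open>c < 1\<close> by (intro tendsto_mult_left_zero LIMSEQ_power_zero) auto
    then have "\<forall>\<^sub>F k in sequentially. c ^ k * M < \<epsilon>"
      using \<open>\<epsilon> > 0\<close> by (rule order_tendstoD)
    then obtain k where "c ^ k * M < \<epsilon>"
      using eventually_happens by fastforce
    then have "merit \<mu> (objective f g) (X k) < ereal \<epsilon>"
      using rate[of k] by (auto elim: le_less_trans)
    with xs_le(2) X_fdom show "\<exists>x\<in>fdom. (\<forall>i. Fr i xs \<le> Fr i x) \<and> merit \<mu> (objective f g) x < ereal \<epsilon>"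
      by blast
  qed
  with xs show ?thesis
    by (rule that)
qed

end

section \<open>Application to the BBPGMO iterates\<close>

theorem theorem4p3:
  fixes f :: "'m::finite \<Rightarrow> real ^ 'n \<Rightarrow> real"
    and g :: "'m \<Rightarrow> real ^ 'n \<Rightarrow> ereal"
    and L \<mu> :: "'m \<Rightarrow> real"
    and \<sigma> \<gamma> \<alpha>min \<alpha>max :: real
    and xm :: "real ^ 'n"
    and x :: "nat \<Rightarrow> real ^ 'n"
  assumes "\<And>i. continuously_differentiable (f i)"
    and "\<And>i. proper_fun (g i)"
    and "\<And>i. convex_fun (g i)"
    and "\<And>i. lsc_fun (g i)"
    and "\<And>i. smooth_with (L i) (f i)"
    and "\<And>i. \<mu> i > 0"
    and "\<And>i. strongly_convex_with (\<mu> i) (f i)"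
    and "0 < \<sigma>" "\<sigma> < 1" "0 < \<gamma>" "\<gamma> < 1"
    and "0 < \<alpha>min" "\<alpha>min < \<alpha>max"
    and "\<alpha>min \<le> (MIN i. \<mu> i)" "\<alpha>max \<ge> (MAX i. L i)"
    and "\<And>i. objective f g i (x 0) \<noteq> \<infinity>"
    and "bbpgmo_sequence \<sigma> \<gamma> \<alpha>min \<alpha>max f g xm x"
    and "\<And>k. \<not> pareto_critical (objective f g) (x k)"
  shows "(\<exists>xs. pareto_solution (objective f g) xs \<and> x \<longlonglongrightarrow> xs) \<and>
    (\<forall>k. merit \<mu> (objective f g) (x (Suc k))
       \<le> ereal (1 - 2 * \<gamma> * \<sigma> * (1 - \<sigma>) * (MIN i. \<mu> i / L i) ^ 3)
           * merit \<mu> (objective f g) (x k))"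
proof -
  note par = \<open>0 < \<sigma>\<close> \<open>\<sigma> < 1\<close> \<open>0 < \<gamma>\<close> \<open>\<gamma> < 1\<close>
  interpret strongly_convex_composite f g L \<mu>
    by unfold_locales fact+
  define \<rho> where "\<rho> = 2 * \<gamma> * \<sigma> * (1 - \<sigma>) * \<kappa>"
  define prev where "prev k = (case k of 0 \<Rightarrow> xm | Suc j \<Rightarrow> x j)" for k
  have step: "bbpgmo_step \<sigma> \<gamma> \<alpha>min \<alpha>max f g (prev k) (x k) (x (Suc k))" for k
    using \<open>bbpgmo_sequence \<sigma> \<gamma> \<alpha>min \<alpha>max f g xm x\<close>
    unfolding bbpgmo_sequence_def prev_def by blast
  have \<alpha>b: "\<alpha>min \<le> \<mu> i" "L i \<le> \<alpha>max" for i
    using \<open>\<alpha>min \<le> (MIN i. \<mu> i)\<close> \<open>\<alpha>max \<ge> (MAX i. L i)\<close> by auto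
  \<comment> \<open>Distinctness of consecutive points is carried along because the next
    Barzilai-Borwein quotient divides by their squared distance.\<close>
  have iterate: "x k \<in> fdom \<and> prev k \<noteq> x k" for k
  proof (induction k)
    case 0
    show ?case
      using assms(16) \<open>bbpgmo_sequence \<sigma> \<gamma> \<alpha>min \<alpha>max f g xm x\<close>
      by (simp add: fdom_iff prev_def bbpgmo_sequence_def)
  next
    case (Suc k)
    then show ?case
      using bbpgmo_step_decrease[OF step[of k] _ _ par \<alpha>b] by (metis nat.case(2) prev_def)
  qed
  have "\<exists>v. (\<forall>i. \<mu> i * (\<rho> * v) \<le> Fr i (x k) - Fr i (x (Suc k))) \<and>
      (\<forall>i. \<mu> i * (\<sigma> * (norm (x (Suc k) - x k))\<^sup>2) \<le> Fr i (x k) - Fr i (x (Suc k))) \<and>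
      merit \<mu> (objective f g) (x k) \<le> ereal (v / \<kappa>\<^sup>2)" for k
    using bbpgmo_step_decrease[OF step[of k] _ _ par \<alpha>b] iterate[of k] unfolding \<rho>_def by metis
  then obtain v where v: "\<And>k i. \<mu> i * (\<rho> * v k) \<le> Fr i (x k) - Fr i (x (Suc k))"
    and decr: "\<And>k i. \<mu> i * (\<sigma> * (norm (x (Suc k) - x k))\<^sup>2) \<le> Fr i (x k) - Fr i (x (Suc k))"
    and merit_v: "\<And>k. merit \<mu> (objective f g) (x k) \<le> ereal (v k / \<kappa>\<^sup>2)"
    by metis
  have "0 < \<rho>"
    using par \<kappa>_pos by (simp add: \<rho>_def)
  have merit_le: "merit \<mu> (objective f g) (x (Suc k)) \<le>
      ereal (1 - \<rho> * \<kappa>\<^sup>2) * merit \<mu> (objective f g) (x k)" for k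
    using iterate \<open>0 < \<rho>\<close> by (intro merit_decrease[OF _ _ _ v merit_v]) auto
  \<comment> \<open>The contraction factor must be nonnegative for the merit bound to be iterated;
    this comes from \<open>\<sigma> * (1 - \<sigma>) \<le> 1 / 4\<close>.\<close>
  have "\<rho> * \<kappa>\<^sup>2 \<le> 1"
  proof -
    have "\<sigma> * (1 - \<sigma>) \<le> 1 / 4"
      using zero_le_power2[of "\<sigma> - 1 / 2"] by (simp add: power2_eq_square algebra_simps)
    moreover have "\<gamma> * \<kappa> ^ 3 \<le> 1"
      using par \<kappa>_pos \<kappa>_le_1 by (intro mult_le_one power_le_one) auto
    ultimately have "(\<sigma> * (1 - \<sigma>)) * (\<gamma> * \<kappa> ^ 3) \<le> 1 / 4 * 1"
      using par \<kappa>_pos by (intro mult_mono) auto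
    moreover have "\<rho> * \<kappa>\<^sup>2 = 2 * ((\<sigma> * (1 - \<sigma>)) * (\<gamma> * \<kappa> ^ 3))"
      by (simp add: \<rho>_def power2_eq_square power3_eq_cube)
    ultimately show ?thesis
      by linarith
  qed
  then have rate: "0 \<le> 1 - \<rho> * \<kappa>\<^sup>2"
    by simp
  have "1 - \<rho> * \<kappa>\<^sup>2 < 1"
    using \<open>0 < \<rho>\<close> \<kappa>_pos by simp
  from tendsto_pareto_solution[where X = x and \<sigma> = \<sigma>, OF assms(4) conjunct1[OF iterate] par(1) decr
      rate this merit_le merit_v]
  obtain xs where "x \<longlonglongrightarrow> xs" "pareto_solution (objective f g) xs" .
  moreover have "2 * \<gamma> * \<sigma> * (1 - \<sigma>) * (MIN i. \<mu> i / L i) ^ 3 = \<rho> * \<kappa>\<^sup>2"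
    unfolding \<kappa>_def[symmetric] by (simp add: \<rho>_def power2_eq_square power3_eq_cube)
  ultimately show ?thesis
    using merit_le by auto
qed

end
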